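(* Let $\theta$ be a joint distribution of $(X_1,\dots,X_n,W)$, let $\mathbf{x}$ be a stimulus with $\Pr[\mathbf{X}=\mathbf{x}]>0$, let $\epsilon\ge0$ and $d>0$, and let $h,h'$ be histories with $\mathbf{x}\in R_h$ and $\mathbf{x}\in R_{h'}$. If both $(\theta,h)$ and $(\theta,h')$ are $\epsilon$-consensuses and both $\Pr[h\mid h']$ and $\Pr[h'\mid h]$ are strictly greater than $\frac{2\,g(\theta,\mathbf{x},\epsilon)}{d^2}$, then $D_{TV}(\mathbf{q}_h,\mathbf{q}_{h'})<d$.
   Context: $X_1,\dots,X_n,W$ are random variables with finite realization spaces $\mathcal{S}_1,\dots,\mathcal{S}_n,\Omega$; the information structure $\theta$ is their joint distribution, and all probabilities are with respect to $\theta$. Write $\mathbf{X}=(X_1,\dots,X_n)$; a stimulus is a realization $\mathbf{x}=(x_1,\dots,x_n)$ of $\mathbf{X}$. A history $h$ is identified with a hyperrectangle $R_h=B_1\times\cdots\times B_n$ with $B_i\subset\mathcal{S}_i$; conditioning on $h$ means conditioning on the event $\{\mathbf{X}\in R_h\}$, which is assumed to have positive probability. $\Pr[h'\mid h]=\Pr[\mathbf{X}\in R_{h'}\mid \mathbf{X}\in R_h]$, and $\mathbf{q}_h(\omega)=\Pr[W=\omega\mid h]$. $\mathrm{I}(A;B\mid h)$ denotes the mutual information (logarithms in base $2$) of $A$ and $B$ under the conditional distribution given the event $h$. $(\theta,h)$ achieves $\epsilon$-consensus if $\mathrm{I}(X_i;W\mid h)\le\epsilon$ for all $i=1,\dots,n$.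 The Gestalt complexity of the stimulus $\mathbf{x}$ is $$g(\theta,\mathbf{x},\epsilon)=\max\{\mathrm{I}(\mathbf{X};W\mid h): R_h\ni\mathbf{x},\ (\theta,h)\text{ is an }\epsilon\text{-consensus}\}.$$ $D_{TV}(\mathbf{p},\mathbf{q})=\frac12\sum_{\omega}|\mathbf{p}(\omega)-\mathbf{q}(\omega)|$. *)

theory Defs
  imports "HOL-Probability.Probability"
begin

text \<open>
  The joint distribution of \<open>(X\<^sub>1, \<dots>, X\<^sub>n, W)\<close> is a probability measure \<open>\<theta>\<close> on the finite discrete
  space \<open>(S\<^sub>1 \<times> \<dots> \<times> S\<^sub>n) \<times> \<Omega>\<close>. The realization spaces \<open>S\<^sub>i\<close> are arbitrary finite subsets of one common
  type \<open>'a\<close>, and a tuple \<open>(x\<^sub>1, \<dots>, x\<^sub>n)\<close> is an extensional function on \<open>{1..n}\<close>. The random variables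
  are the coordinate maps: \<open>X = fst\<close>, \<open>X\<^sub>i = (\<lambda>s. fst s i)\<close> and \<open>W = snd\<close>.
\<close>

definition information_structure ::
    "nat \<Rightarrow> (nat \<Rightarrow> 'a set) \<Rightarrow> 'w set \<Rightarrow> ((nat \<Rightarrow> 'a) \<times> 'w) measure \<Rightarrow> bool" where
  "information_structure n S \<Omega> \<theta> \<longleftrightarrow>
     (\<forall>i\<in>{1..n}. finite (S i)) \<and> finite \<Omega> \<and>
     prob_space \<theta> \<and>
     space \<theta> = (\<Pi>\<^sub>E i\<in>{1..n}. S i) \<times> \<Omega> \<and>
     sets \<theta> = Pow ((\<Pi>\<^sub>E i\<in>{1..n}. S i) \<times> \<Omega>)"

text \<open>A history is identified with its hyperrectangle \<open>B\<^sub>1 \<times> \<dots> \<times> B\<^sub>n\<close> and has positive probability.\<close>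

definition histories ::
    "nat \<Rightarrow> (nat \<Rightarrow> 'a set) \<Rightarrow> ((nat \<Rightarrow> 'a) \<times> 'w) measure \<Rightarrow> (nat \<Rightarrow> 'a) set set" where
  "histories n S \<theta> =
     {h. (\<exists>B. (\<forall>i\<in>{1..n}. B i \<subseteq> S i) \<and> h = (\<Pi>\<^sub>E i\<in>{1..n}. B i)) \<and> \<P>(s in \<theta>. fst s \<in> h) > 0}"

definition given ::
    "((nat \<Rightarrow> 'a) \<times> 'w) measure \<Rightarrow> (nat \<Rightarrow> 'a) set \<Rightarrow> ((nat \<Rightarrow> 'a) \<times> 'w) measure" where
  "given \<theta> h = uniform_measure \<theta> {s \<in> space \<theta>. fst s \<in> h}"

definition belief :: "((nat \<Rightarrow> 'a) \<times> 'w) measure \<Rightarrow> (nat \<Rightarrow> 'a) set \<Rightarrow> 'w \<Rightarrow> real" where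
  "belief \<theta> h \<omega> = \<P>(s in \<theta>. snd s = \<omega> \<bar> fst s \<in> h)"

definition info_single ::
    "(nat \<Rightarrow> 'a set) \<Rightarrow> 'w set \<Rightarrow> ((nat \<Rightarrow> 'a) \<times> 'w) measure \<Rightarrow> nat \<Rightarrow> (nat \<Rightarrow> 'a) set \<Rightarrow> real" where
  "info_single S \<Omega> \<theta> i h =
     prob_space.mutual_information (given \<theta> h) 2
       (count_space (S i)) (count_space \<Omega>) (\<lambda>s. fst s i) snd"

definition info_joint ::
    "nat \<Rightarrow> (nat \<Rightarrow> 'a set) \<Rightarrow> 'w set \<Rightarrow> ((nat \<Rightarrow> 'a) \<times> 'w) measure \<Rightarrow> (nat \<Rightarrow> 'a) set \<Rightarrow> real" where
  "info_joint n S \<Omega> \<theta> h =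
     prob_space.mutual_information (given \<theta> h) 2
       (count_space (\<Pi>\<^sub>E i\<in>{1..n}. S i)) (count_space \<Omega>) fst snd"

definition consensus ::
    "nat \<Rightarrow> (nat \<Rightarrow> 'a set) \<Rightarrow> 'w set \<Rightarrow> ((nat \<Rightarrow> 'a) \<times> 'w) measure \<Rightarrow> (nat \<Rightarrow> 'a) set \<Rightarrow> real \<Rightarrow> bool"
  where
  "consensus n S \<Omega> \<theta> h \<epsilon> \<longleftrightarrow> (\<forall>i\<in>{1..n}. info_single S \<Omega> \<theta> i h \<le> \<epsilon>)"

text \<open>
  There are finitely many hyperrectangles, so the maximum ranges over a finite set. If \<open>\<epsilon> \<ge> 0\<close> and the
  stimulus \<open>x\<close> has positive probability, the set is nonempty: it contains the value at \<open>{x}\<close>.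
\<close>

definition gestalt_complexity ::
    "nat \<Rightarrow> (nat \<Rightarrow> 'a set) \<Rightarrow> 'w set \<Rightarrow> ((nat \<Rightarrow> 'a) \<times> 'w) measure \<Rightarrow> (nat \<Rightarrow> 'a) \<Rightarrow> real \<Rightarrow> real"
  where
  "gestalt_complexity n S \<Omega> \<theta> x \<epsilon> =
     Max {info_joint n S \<Omega> \<theta> h | h. h \<in> histories n S \<theta> \<and> x \<in> h \<and> consensus n S \<Omega> \<theta> h \<epsilon>}"

definition D_TV :: "'w set \<Rightarrow> ('w \<Rightarrow> real) \<Rightarrow> ('w \<Rightarrow> real) \<Rightarrow> real" where
  "D_TV \<Omega> p q = (\<Sum>\<omega>\<in>\<Omega>. \<bar>p \<omega> - q \<omega>\<bar>) / 2"

end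

theory Submission
  imports Defs
begin

text \<open>
  With \<open>A = h \<inter> h'\<close> and \<open>p = Pr[h' | h]\<close>, restricting the relative entropy
  \<open>I(X;W | h)\<close> between the joint law and the product of its marginals to the slice \<open>X \<in> A\<close> and
  applying Pinsker's inequality there gives \<open>2 p D\<^sub>T\<^sub>V(q\<^sub>A, q\<^sub>h)\<^sup>2 \<le> ln 2 \<cdot> I(X;W | h)\<close>. Hence
  \<open>D\<^sub>T\<^sub>V(q\<^sub>A, q\<^sub>h) < d / 2\<close>; by symmetry the same holds for \<open>h'\<close>, and the triangle inequality through
  \<open>q\<^sub>A\<close> concludes.
\<close>

section \<open>Scalar inequalities and Pinsker's inequality on a slice\<close>

text \<open>The difference of the two sides vanishes together with its first derivative at 1, and
  its second derivative is nonnegative, so 1 is a global minimum. The rational function matches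
  \<open>u * ln u - u + 1\<close> to third order at 1, which is what keeps Pinsker's constant sharp
  after summation.\<close>

lemma xlogx_lower_bound:
  fixes u :: real
  assumes "u > 0"
  shows "3 * (u - 1)\<^sup>2 / (2 * (u + 2)) \<le> u * ln u - u + 1"
proof -
  define \<phi> where "\<phi> = (\<lambda>t::real. t * ln t - t + 1 - 3 * (t - 1)\<^sup>2 / (2 * (t + 2)))"
  define \<phi>' where "\<phi>' = (\<lambda>t::real. ln t - 3 * (t - 1) * (t + 5) / (2 * (t + 2)\<^sup>2))"
  have D: "(\<phi> has_real_derivative \<phi>' t) (at t)" if "t > 0" for t
  proof -
    have "((\<lambda>t. t * ln t - t + 1 - 3 * (t - 1)\<^sup>2 / (2 * (t + 2))) has_real_derivative
        ln t - (6 * (t - 1) * (2 * (t + 2)) - 3 * (t - 1)\<^sup>2 * 2) / (2 * (t + 2))\<^sup>2) (at t)"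
      using that by (auto intro!: derivative_eq_intros simp: power2_eq_square)
    moreover have "(6 * (t - 1) * (2 * (t + 2)) - 3 * (t - 1)\<^sup>2 * 2) / (2 * (t + 2))\<^sup>2
        = 3 * (t - 1) * (t + 5) / (2 * (t + 2)\<^sup>2)"
      using that by (simp add: divide_simps) (simp add: power2_eq_square algebra_simps)
    ultimately show ?thesis
      by (simp add: \<phi>_def \<phi>'_def)
  qed
  have D': "(\<phi>' has_real_derivative (1 / t - 27 / (t + 2) ^ 3)) (at t)" if "t > 0" for t
  proof -
    have "((\<lambda>t. ln t - 3 * (t - 1) * (t + 5) / (2 * (t + 2)\<^sup>2)) has_real_derivative
        1 / t - ((6 * t + 12) * (2 * (t + 2)\<^sup>2) - 3 * (t - 1) * (t + 5) * (4 * (t + 2)))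
          / (2 * (t + 2)\<^sup>2)\<^sup>2) (at t)"
      using that
      by (auto intro!: derivative_eq_intros simp: power2_eq_square)
    moreover have "((6 * t + 12) * (2 * (t + 2)\<^sup>2) - 3 * (t - 1) * (t + 5) * (4 * (t + 2)))
          / (2 * (t + 2)\<^sup>2)\<^sup>2 = 27 / (t + 2) ^ 3"
      using that by (simp add: divide_simps) (simp add: eval_nat_numeral algebra_simps)
    ultimately show ?thesis
      by (simp add: \<phi>'_def)
  qed
  \<comment> \<open>AM-GM for t, 1, 1 in cubed form; the factorization is its certificate, with a
    double zero at t = 1.\<close>
  have D'_nonneg: "1 / t - 27 / (t + 2) ^ 3 \<ge> 0" if "t > 0" for t :: real
  proof -
    have "(t + 2) ^ 3 - 27 * t = (t - 1)\<^sup>2 * (t + 8)"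
      by (simp add: power2_eq_square power3_eq_cube algebra_simps)
    then have "27 * t \<le> (t + 2) ^ 3"
      using that by (smt (verit) mult_nonneg_nonneg zero_le_power2)
    then show ?thesis
      using that by (simp add: divide_simps)
  qed
  have mono: "\<phi>' s \<le> \<phi>' t" if "0 < s" "s \<le> t" for s t
  proof (rule DERIV_nonneg_imp_nondecreasing[OF \<open>s \<le> t\<close>])
    fix y assume "s \<le> y"
    then have "y > 0"
      using \<open>0 < s\<close> by simp
    then show "\<exists>z. (\<phi>' has_real_derivative z) (at y) \<and> 0 \<le> z"
      using D' D'_nonneg by blast
  qed
  have "\<phi>' 1 = 0" "\<phi> 1 = 0"
    by (simp_all add: \<phi>_def \<phi>'_def)
  have "\<phi> u \<ge> \<phi> 1"
  proof (cases "u \<ge> 1")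
    case True
    show ?thesis
    proof (rule DERIV_nonneg_imp_nondecreasing[OF True])
      fix y :: real assume "1 \<le> y"
      then show "\<exists>z. (\<phi> has_real_derivative z) (at y) \<and> 0 \<le> z"
        using D[of y] mono[of 1 y] \<open>\<phi>' 1 = 0\<close> by auto
    qed
  next
    case False
    then have "u \<le> 1" by simp
    then show ?thesis
    proof (rule DERIV_nonpos_imp_nonincreasing)
      fix y assume "u \<le> y" "y \<le> 1"
      then show "\<exists>z. (\<phi> has_real_derivative z) (at y) \<and> z \<le> 0"
        using D[of y] mono[of y 1] \<open>\<phi>' 1 = 0\<close> assms by auto
    qed
  qed
  then show ?thesis
    using \<open>\<phi> 1 = 0\<close> by (simp add: \<phi>_def)
qed

text \<open>Homogenized form of the scalar bound: put u = p / q and multiply by q. The last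
  hypothesis is absolute continuity at a point. The linear part \<open>- p + q\<close> makes each
  single term nonnegative and cancels when summed over two distributions of equal mass.\<close>

lemma relative_entropy_term_lower_bound:
  fixes p q :: real
  assumes "p \<ge> 0" "q \<ge> 0" "q = 0 \<Longrightarrow> p = 0"
  shows "3 * (p - q)\<^sup>2 / (2 * (p + 2 * q)) \<le> p * ln (p / q) - p + q"
proof (cases "p = 0 \<or> q = 0")
  case True
  then show ?thesis
    using assms by (auto simp: power2_eq_square divide_simps)
next
  case False
  then have pos: "p > 0" "q > 0"
    using assms by auto
  have "q * (3 * (p / q - 1)\<^sup>2 / (2 * (p / q + 2))) \<le> q * (p / q * ln (p / q) - p / q + 1)"
    using xlogx_lower_bound[of "p / q"] pos by (intro mult_left_mono) auto
  moreover have "q * (p / q * ln (p / q) - p / q + 1) = p * ln (p / q) - p + q"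
    using pos by (simp add: field_simps)
  moreover have "q * (3 * (p / q - 1)\<^sup>2 / (2 * (p / q + 2))) = 3 * (p - q)\<^sup>2 / (2 * (p + 2 * q))"
  proof -
    have "p / q - 1 = (p - q) / q" "p / q + 2 = (p + 2 * q) / q"
      using pos by (simp_all add: field_simps)
    then show ?thesis
      using pos by (simp add: power2_eq_square)
  qed
  ultimately show ?thesis
    by simp
qed

text \<open>Cauchy-Schwarz for the factorization of |a| into sqrt c and |a| / sqrt c. Where c
  vanishes the quotient is 0 by convention, so a has to vanish there too.\<close>

lemma sum_abs_squared_le_weighted:
  fixes a c :: "'i \<Rightarrow> real"
  assumes "\<And>i. i \<in> I \<Longrightarrow> c i \<ge> 0" "\<And>i. i \<in> I \<Longrightarrow> c i = 0 \<Longrightarrow> a i = 0"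
  shows "(\<Sum>i\<in>I. \<bar>a i\<bar>)\<^sup>2 \<le> (\<Sum>i\<in>I. c i) * (\<Sum>i\<in>I. (a i)\<^sup>2 / c i)"
proof -
  have "(\<Sum>i\<in>I. \<bar>a i\<bar>) = (\<Sum>i\<in>I. sqrt (c i) * (\<bar>a i\<bar> / sqrt (c i)))"
    using assms by (intro sum.cong) auto
  moreover have "(\<Sum>i\<in>I. (sqrt (c i))\<^sup>2) = (\<Sum>i\<in>I. c i)"
    using assms by (intro sum.cong) auto
  moreover have "(\<Sum>i\<in>I. (\<bar>a i\<bar> / sqrt (c i))\<^sup>2) = (\<Sum>i\<in>I. (a i)\<^sup>2 / c i)"
    using assms by (intro sum.cong) (auto simp: power_divide)
  ultimately show ?thesis
    using Cauchy_Schwarz_ineq_sum[of "\<lambda>i. sqrt (c i)" "\<lambda>i. \<bar>a i\<bar> / sqrt (c i)" I] by simp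
qed

text \<open>
  The pointwise bound makes every term \<open>P ln (P / Q) - P + Q\<close> nonnegative, so the sum over
  \<open>F \<times> \<Omega>\<close> may be cut down to \<open>A \<times> \<Omega>\<close>; Cauchy--Schwarz with weights \<open>P + 2 Q\<close>, of total mass \<open>3 p\<close> on
  the slice, then yields the bound.
\<close>

lemma restricted_pinsker:
  fixes P :: "'x \<Rightarrow> 'w \<Rightarrow> real"
  defines "r \<equiv> \<lambda>\<Omega> x. \<Sum>w\<in>\<Omega>. P x w" and "q \<equiv> \<lambda>F w. \<Sum>x\<in>F. P x w"
  assumes fin: "finite F" "finite \<Omega>" and "A \<subseteq> F"
    and nonneg: "\<And>x w. x \<in> F \<Longrightarrow> w \<in> \<Omega> \<Longrightarrow> P x w \<ge> 0"
    and total: "(\<Sum>x\<in>F. r \<Omega> x) = 1"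
  shows "(\<Sum>w\<in>\<Omega>. \<bar>q A w - (\<Sum>x\<in>A. r \<Omega> x) * q F w\<bar>)\<^sup>2
    \<le> 2 * (\<Sum>x\<in>A. r \<Omega> x) * (\<Sum>(x, w)\<in>F \<times> \<Omega>. P x w * ln (P x w / (r \<Omega> x * q F w)))"
proof -
  let ?Q = "\<lambda>x w. r \<Omega> x * q F w"
  let ?k = "\<lambda>x w. P x w * ln (P x w / ?Q x w)"
  let ?c = "\<lambda>x w. P x w + 2 * ?Q x w"
  let ?p = "\<Sum>x\<in>A. r \<Omega> x"
  have finA: "finite A"
    using fin \<open>A \<subseteq> F\<close> finite_subset by blast
  have Q0: "?Q x w \<ge> 0" if "x \<in> F" "w \<in> \<Omega>" for x w
    unfolding r_def q_def using that nonneg by (intro mult_nonneg_nonneg sum_nonneg) auto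
  \<comment> \<open>A marginal is a sum of nonnegative entries, so if it vanishes then so does each
    entry: the joint law is absolutely continuous with respect to the product of its
    marginals.\<close>
  have QP: "P x w = 0" if "?Q x w = 0" "x \<in> F" "w \<in> \<Omega>" for x w
    using that nonneg fin unfolding r_def q_def mult_eq_0_iff
    by (metis (mono_tags, lifting) sum_nonneg_eq_0_iff)
  have term_bound: "3 / 2 * ((P x w - ?Q x w)\<^sup>2 / ?c x w) \<le> ?k x w - P x w + ?Q x w"
    if "x \<in> F" "w \<in> \<Omega>" for x w
    using relative_entropy_term_lower_bound[of "P x w" "?Q x w"] nonneg Q0 QP that by auto
  have c0: "?c x w \<ge> 0" if "x \<in> F" "w \<in> \<Omega>" for x w
    using nonneg Q0 that by (simp add: add_nonneg_nonneg)
  have qsum: "(\<Sum>w\<in>\<Omega>. q F w) = 1"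
    using total unfolding q_def r_def by (subst sum.swap)
  \<comment> \<open>\<open>P\<close> and \<open>?Q\<close> have equal mass over every set of rows.
    For B = A this gives the total weight p + 2p; for B = F it cancels the linear terms of the
    pointwise bound.\<close>
  have massQ: "(\<Sum>(x, w)\<in>B \<times> \<Omega>. ?Q x w) = (\<Sum>x\<in>B. r \<Omega> x)" for B
    using qsum by (simp add: sum.cartesian_product[symmetric] sum_distrib_left[symmetric])
  have massP: "(\<Sum>(x, w)\<in>B \<times> \<Omega>. P x w) = (\<Sum>x\<in>B. r \<Omega> x)" for B
    by (simp add: sum.cartesian_product[symmetric] r_def)
  have p0: "?p \<ge> 0"
    using nonneg \<open>A \<subseteq> F\<close> unfolding r_def by (intro sum_nonneg) auto
  \<comment> \<open>Summing \<open>P - ?Q\<close> over the rows of A gives the signed difference on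
    the left, since the second factor of \<open>?Q\<close> does not depend on x.\<close>
  have "(\<Sum>w\<in>\<Omega>. \<bar>q A w - ?p * q F w\<bar>) = (\<Sum>w\<in>\<Omega>. \<bar>\<Sum>x\<in>A. P x w - ?Q x w\<bar>)"
    by (simp add: q_def sum_subtractf sum_distrib_right)
  also have "\<dots> \<le> (\<Sum>w\<in>\<Omega>. \<Sum>x\<in>A. \<bar>P x w - ?Q x w\<bar>)"
    by (intro sum_mono sum_abs)
  also have "\<dots> = (\<Sum>z\<in>A \<times> \<Omega>. \<bar>case z of (x, w) \<Rightarrow> P x w - ?Q x w\<bar>)"
    by (subst sum.swap) (simp add: sum.cartesian_product split_def)
  finally have "(\<Sum>w\<in>\<Omega>. \<bar>q A w - ?p * q F w\<bar>)\<^sup>2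
      \<le> (\<Sum>z\<in>A \<times> \<Omega>. \<bar>case z of (x, w) \<Rightarrow> P x w - ?Q x w\<bar>)\<^sup>2"
    by (intro power_mono sum_nonneg) auto
  also have "\<dots> \<le> (\<Sum>(x, w)\<in>A \<times> \<Omega>. ?c x w)
      * (\<Sum>z\<in>A \<times> \<Omega>. (case z of (x, w) \<Rightarrow> P x w - ?Q x w)\<^sup>2 / (case z of (x, w) \<Rightarrow> ?c x w))"
  proof (rule sum_abs_squared_le_weighted)
    fix z assume "z \<in> A \<times> \<Omega>"
    then obtain x w where z: "z = (x, w)" "x \<in> F" "w \<in> \<Omega>"
      using \<open>A \<subseteq> F\<close> by auto
    show "(case z of (x, w) \<Rightarrow> ?c x w) \<ge> 0"
      using c0 z by simp
    assume "(case z of (x, w) \<Rightarrow> ?c x w) = 0"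
    then have "P x w = 0 \<and> ?Q x w = 0"
      using nonneg[OF z(2,3)] Q0[OF z(2,3)] z(1) by (simp only: split) linarith
    then show "(case z of (x, w) \<Rightarrow> P x w - ?Q x w) = 0"
      using z by simp
  qed
  also have "(\<Sum>(x, w)\<in>A \<times> \<Omega>. ?c x w) = 3 * ?p"
    using massP[of A] massQ[of A]
    by (simp add: split_def sum.distrib sum_distrib_left[symmetric])
  \<comment> \<open>The 3 is split as 2 * (3 / 2), so that 3 / 2 meets the constant of
    \<open>term_bound\<close>.\<close>
  also have "3 * ?p * (\<Sum>z\<in>A \<times> \<Omega>. (case z of (x, w) \<Rightarrow> P x w - ?Q x w)\<^sup>2 / (case z of (x, w) \<Rightarrow> ?c x w))
      = 2 * ?p * (\<Sum>(x, w)\<in>A \<times> \<Omega>. 3 / 2 * ((P x w - ?Q x w)\<^sup>2 / ?c x w))"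
    unfolding split_def sum_distrib_left[symmetric] by simp
  also have "\<dots> \<le> 2 * ?p * (\<Sum>(x, w)\<in>F \<times> \<Omega>. ?k x w)"
  proof (rule mult_left_mono)
    have "(\<Sum>(x, w)\<in>A \<times> \<Omega>. 3 / 2 * ((P x w - ?Q x w)\<^sup>2 / ?c x w))
        \<le> (\<Sum>(x, w)\<in>F \<times> \<Omega>. 3 / 2 * ((P x w - ?Q x w)\<^sup>2 / ?c x w))"
    proof (rule sum_mono2)
      fix z assume "z \<in> F \<times> \<Omega> - A \<times> \<Omega>"
      then show "(case z of (x, w) \<Rightarrow> 3 / 2 * ((P x w - ?Q x w)\<^sup>2 / ?c x w)) \<ge> 0"
        using c0 by (auto simp only: split intro!: mult_nonneg_nonneg divide_nonneg_nonneg zero_le_power2)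
    qed (use fin \<open>A \<subseteq> F\<close> in auto)
    also have "\<dots> \<le> (\<Sum>(x, w)\<in>F \<times> \<Omega>. ?k x w - P x w + ?Q x w)"
      using term_bound by (intro sum_mono) auto
    also have "\<dots> = (\<Sum>(x, w)\<in>F \<times> \<Omega>. ?k x w)"
      using massP[of F] massQ[of F] by (simp add: split_def sum.distrib sum_subtractf)
    finally show "(\<Sum>(x, w)\<in>A \<times> \<Omega>. 3 / 2 * ((P x w - ?Q x w)\<^sup>2 / ?c x w))
        \<le> (\<Sum>(x, w)\<in>F \<times> \<Omega>. ?k x w)" .
  qed (use p0 in simp)
  finally show ?thesis .
qed

section \<open>Mutual information on a finite product space\<close>

text \<open>Every function on a finite discrete space is simple, so the formula for simple
  distributions applies. Here the events "first coordinate is x" and "second coordinate is w" are a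
  row and a column of the product.\<close>

lemma mutual_information_coordinates:
  fixes M :: "('x \<times> 'w) measure"
  assumes "prob_space M" and space: "space M = F \<times> \<Omega>" and sets: "sets M = Pow (F \<times> \<Omega>)"
    and fin: "finite F" "finite \<Omega>" and "b > 1"
  shows "prob_space.mutual_information M b (count_space F) (count_space \<Omega>) fst snd
    = (\<Sum>(x, w)\<in>F \<times> \<Omega>. measure M {(x, w)} *
        log b (measure M {(x, w)} / (measure M ({x} \<times> \<Omega>) * measure M (F \<times> {w}))))"
proof -
  interpret prob_space M
    by fact
  interpret information_space M b
    by unfold_locales fact
  \<comment> \<open>A projection maps the product onto a factor only if the other factor is
    nonempty.\<close>
  have "F \<noteq> {}" "\<Omega> \<noteq> {}"
    using not_empty space by auto
  then have img: "fst ` space M = F" "snd ` space M = \<Omega>"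
    by (simp_all add: space)
  have simple: "simple_function M f" for f :: "'x \<times> 'w \<Rightarrow> 'c"
    using fin by (auto simp: simple_function_def space sets)
  have "mutual_information b (count_space (fst ` space M)) (count_space (snd ` space M)) fst snd
    = (\<Sum>(x, w)\<in>(\<lambda>z. (fst z, snd z)) ` space M. prob {(x, w)} *
        log b (prob {(x, w)} / (prob ({x} \<times> \<Omega>) * prob (F \<times> {w}))))"
  proof (rule mutual_information_simple_distributed)
    show "simple_distributed M fst (\<lambda>x. prob ({x} \<times> \<Omega>))"
      by (rule simple_distributedI[OF simple])
        (auto simp: space split: if_splits intro!: arg_cong[where f = prob])
    show "simple_distributed M snd (\<lambda>w. prob (F \<times> {w}))"
      by (rule simple_distributedI[OF simple])
        (auto simp: space split: if_splits intro!: arg_cong[where f = prob])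
    show "simple_distributed M (\<lambda>z. (fst z, snd z)) (\<lambda>z. prob {z})"
      by (rule simple_distributedI[OF simple])
        (auto simp: space intro!: arg_cong[where f = prob])
  qed
  then show ?thesis
    unfolding img prod.collapse image_ident by (simp only: space)
qed

text \<open>\<open>restricted_pinsker\<close> for the point masses of M; its sums over rows and
  columns become probabilities of rectangles. The factor \<open>ln 2\<close> converts bits into
  nats.\<close>

lemma restricted_pinsker_mutual_information:
  fixes M :: "('x \<times> 'w) measure"
  assumes "prob_space M" and space: "space M = F \<times> \<Omega>" and sets: "sets M = Pow (F \<times> \<Omega>)"
    and fin: "finite F" "finite \<Omega>" and "A \<subseteq> F"
  shows "(\<Sum>w\<in>\<Omega>. \<bar>measure M (A \<times> {w}) - measure M (A \<times> \<Omega>) * measure M (F \<times> {w})\<bar>)\<^sup>2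
    \<le> 2 * measure M (A \<times> \<Omega>) *
        (ln 2 * prob_space.mutual_information M 2 (count_space F) (count_space \<Omega>) fst snd)"
proof -
  interpret prob_space M
    by fact
  have rect: "prob (B \<times> C) = (\<Sum>x\<in>B. \<Sum>w\<in>C. prob {(x, w)})" if "B \<subseteq> F" "C \<subseteq> \<Omega>" for B C
  proof -
    have "finite (B \<times> C)"
      using fin that by (intro finite_cartesian_product) (auto intro: finite_subset)
    then have "prob (B \<times> C) = (\<Sum>z\<in>B \<times> C. prob {z})"
      using that sets by (intro finite_measure_eq_sum_singleton) auto
    then show ?thesis
      by (simp add: sum.cartesian_product split_def)
  qed
  have row: "(\<Sum>w\<in>\<Omega>. prob {(x, w)}) = prob ({x} \<times> \<Omega>)" if "x \<in> F" for x
    using rect[of "{x}" \<Omega>] that by simp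
  have col: "(\<Sum>x\<in>B. prob {(x, w)}) = prob (B \<times> {w})" if "w \<in> \<Omega>" "B \<subseteq> F" for w B
    using rect[of B "{w}"] that by simp
  have "(\<Sum>x\<in>F. \<Sum>w\<in>\<Omega>. prob {(x, w)}) = 1"
    using rect[of F \<Omega>] prob_space space by simp
  from restricted_pinsker[OF fin \<open>A \<subseteq> F\<close> _ this]
  have "(\<Sum>w\<in>\<Omega>. \<bar>(\<Sum>x\<in>A. prob {(x, w)}) - (\<Sum>x\<in>A. \<Sum>w\<in>\<Omega>. prob {(x, w)}) * (\<Sum>x\<in>F. prob {(x, w)})\<bar>)\<^sup>2
    \<le> 2 * (\<Sum>x\<in>A. \<Sum>w\<in>\<Omega>. prob {(x, w)}) * (\<Sum>(x, w)\<in>F \<times> \<Omega>. prob {(x, w)} *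
        ln (prob {(x, w)} / ((\<Sum>w\<in>\<Omega>. prob {(x, w)}) * (\<Sum>x\<in>F. prob {(x, w)}))))"
    by simp
  moreover have "(\<Sum>x\<in>A. \<Sum>w\<in>\<Omega>. prob {(x, w)}) = prob (A \<times> \<Omega>)"
    using rect \<open>A \<subseteq> F\<close> by simp
  moreover have "(\<Sum>(x, w)\<in>F \<times> \<Omega>. prob {(x, w)} *
        ln (prob {(x, w)} / ((\<Sum>w\<in>\<Omega>. prob {(x, w)}) * (\<Sum>x\<in>F. prob {(x, w)}))))
      = (\<Sum>(x, w)\<in>F \<times> \<Omega>. prob {(x, w)} *
        ln (prob {(x, w)} / (prob ({x} \<times> \<Omega>) * prob (F \<times> {w}))))"
    by (intro sum.cong) (auto simp: row col)
  ultimately have "(\<Sum>w\<in>\<Omega>. \<bar>prob (A \<times> {w}) - prob (A \<times> \<Omega>) * prob (F \<times> {w})\<bar>)\<^sup>2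
    \<le> 2 * prob (A \<times> \<Omega>) * (\<Sum>(x, w)\<in>F \<times> \<Omega>. prob {(x, w)} *
        ln (prob {(x, w)} / (prob ({x} \<times> \<Omega>) * prob (F \<times> {w}))))"
    using \<open>A \<subseteq> F\<close> by (simp add: col cong: sum.cong_simp)
  also have "(\<Sum>(x, w)\<in>F \<times> \<Omega>. prob {(x, w)} *
        ln (prob {(x, w)} / (prob ({x} \<times> \<Omega>) * prob (F \<times> {w}))))
      = ln 2 * mutual_information 2 (count_space F) (count_space \<Omega>) fst snd"
    by (simp add: mutual_information_coordinates[OF prob_space_axioms space sets fin]
        sum_distrib_left log_def split_def)
  finally show ?thesis .
qed

section \<open>Beliefs and information under a history\<close>

text \<open>The slice inequality under the conditional measure \<open>given \<theta> h\<close>: the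
  slice A has mass p, its column w has mass p times the belief at A, and the whole column w has mass
  the belief at h. The factor p stays inside the square, so a null set A is covered as well.\<close>

lemma info_joint_lower_bound:
  fixes h A :: "(nat \<Rightarrow> 'a) set"
  assumes \<theta>: "information_structure n S \<Omega> \<theta>" and h: "h \<in> histories n S \<theta>" and "A \<subseteq> h"
  defines "p \<equiv> \<P>(s in \<theta>. fst s \<in> A \<bar> fst s \<in> h)"
  shows "(p * D_TV \<Omega> (belief \<theta> A) (belief \<theta> h))\<^sup>2 \<le> p * (ln 2 * info_joint n S \<Omega> \<theta> h) / 2"
proof -
  let ?F = "\<Pi>\<^sub>E i\<in>{1..n}. S i"
  interpret prob_space \<theta>
    using \<theta> by (simp add: information_structure_def)
  have fin: "finite ?F" "finite \<Omega>" and space: "space \<theta> = ?F \<times> \<Omega>" and sets: "sets \<theta> = Pow (?F \<times> \<Omega>)"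
    using \<theta> by (auto simp: information_structure_def intro!: finite_PiE)
  have hF: "h \<subseteq> ?F" and hpos: "prob (h \<times> \<Omega>) > 0"
  proof -
    obtain B where "\<forall>i\<in>{1..n}. B i \<subseteq> S i" "h = (\<Pi>\<^sub>E i\<in>{1..n}. B i)"
      using h by (auto simp: histories_def)
    then show "h \<subseteq> ?F"
      by (auto intro!: PiE_mono)
    then have "{s \<in> space \<theta>. fst s \<in> h} = h \<times> \<Omega>"
      by (auto simp: space)
    then show "prob (h \<times> \<Omega>) > 0"
      using h by (simp add: histories_def)
  qed
  have event: "{s \<in> space \<theta>. fst s \<in> B} = B \<times> \<Omega>" if "B \<subseteq> h" for B
    using that hF by (auto simp: space)
  have nz: "emeasure \<theta> (h \<times> \<Omega>) \<noteq> 0"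
    using hpos by (simp add: emeasure_eq_measure)
  let ?\<mu> = "given \<theta> h"
  have given: "?\<mu> = uniform_measure \<theta> (h \<times> \<Omega>)"
    by (simp add: given_def event)
  interpret \<mu>: prob_space ?\<mu>
    unfolding given using nz by (rule prob_space_uniform_measure) simp
  have \<mu>_space: "space ?\<mu> = ?F \<times> \<Omega>" "sets ?\<mu> = Pow (?F \<times> \<Omega>)"
    by (simp_all add: given space sets)
  have \<mu>_rect: "\<mu>.prob (B \<times> C) = prob ((h \<inter> B) \<times> C) / prob (h \<times> \<Omega>)"
    if "B \<subseteq> ?F" "C \<subseteq> \<Omega>" for B C
  proof -
    have "h \<times> \<Omega> \<inter> B \<times> C = (h \<inter> B) \<times> C"
      using that by auto
    moreover have "B \<times> C \<in> sets \<theta>"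
      using that by (auto simp: sets)
    ultimately show ?thesis
      using nz by (simp add: given)
  qed
  have AF: "A \<subseteq> ?F"
    using \<open>A \<subseteq> h\<close> hF by blast
  have bel: "belief \<theta> B w = prob (B \<times> {w}) / prob (B \<times> \<Omega>)" if "B \<subseteq> h" "w \<in> \<Omega>" for B w
  proof -
    have "{s \<in> space \<theta>. snd s = w \<and> fst s \<in> B} = B \<times> {w}"
      using that hF by (auto simp: space)
    then show ?thesis
      using that by (simp add: belief_def cond_prob_def event)
  qed
  have p: "p = prob (A \<times> \<Omega>) / prob (h \<times> \<Omega>)"
  proof -
    have "{s \<in> space \<theta>. fst s \<in> A \<and> fst s \<in> h} = A \<times> \<Omega>"
      using \<open>A \<subseteq> h\<close> hF by (auto simp: space)
    then show ?thesis
      by (simp add: p_def cond_prob_def event)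
  qed
  have \<mu>p: "\<mu>.prob (A \<times> \<Omega>) = p"
    using \<mu>_rect[OF AF, of \<Omega>] \<open>A \<subseteq> h\<close> by (simp add: p Int_absorb1)
  have \<mu>A: "\<mu>.prob (A \<times> {w}) = p * belief \<theta> A w" if "w \<in> \<Omega>" for w
  proof -
    have "prob (A \<times> {w}) \<le> prob (A \<times> \<Omega>)"
      using that AF by (intro finite_measure_mono) (auto simp: sets)
    \<comment> \<open>For a null set A the belief is 0 by the convention for division by zero; both
      sides of the claim are then 0.\<close>
    then have "prob (A \<times> {w}) = 0" if "prob (A \<times> \<Omega>) = 0"
      using that by (simp add: measure_le_0_iff)
    then show ?thesis
      using \<mu>_rect[OF AF, of "{w}"] \<open>A \<subseteq> h\<close> that by (auto simp: p bel Int_absorb1)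
  qed
  have \<mu>h: "\<mu>.prob (?F \<times> {w}) = belief \<theta> h w" if "w \<in> \<Omega>" for w
    using \<mu>_rect[of ?F "{w}"] that hF by (simp add: bel Int_absorb2)
  have p0: "p \<ge> 0"
    by (simp add: p)
  have "(\<Sum>w\<in>\<Omega>. \<bar>\<mu>.prob (A \<times> {w}) - \<mu>.prob (A \<times> \<Omega>) * \<mu>.prob (?F \<times> {w})\<bar>)
      = (\<Sum>w\<in>\<Omega>. p * \<bar>belief \<theta> A w - belief \<theta> h w\<bar>)"
    using p0 by (intro sum.cong refl)
      (simp only: \<mu>A \<mu>h \<mu>p abs_mult abs_of_nonneg right_diff_distrib[symmetric])
  also have "\<dots> = 2 * (p * D_TV \<Omega> (belief \<theta> A) (belief \<theta> h))"
    by (simp add: D_TV_def sum_distrib_left[symmetric])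
  finally have "(2 * (p * D_TV \<Omega> (belief \<theta> A) (belief \<theta> h)))\<^sup>2 \<le> 2 * p * (ln 2 * info_joint n S \<Omega> \<theta> h)"
    using restricted_pinsker_mutual_information[OF \<mu>.prob_space_axioms \<mu>_space fin AF]
    by (simp add: \<mu>p info_joint_def)
  then show ?thesis
    by (simp add: power_mult_distrib)
qed

text \<open>The case A = h of the previous bound: p is 1 and the distance of a belief to itself is
  0.\<close>

lemma info_joint_nonneg:
  assumes "information_structure n S \<Omega> \<theta>" "h \<in> histories n S \<theta>"
  shows "info_joint n S \<Omega> \<theta> h \<ge> 0"
proof -
  have "\<P>(s in \<theta>. fst s \<in> h \<bar> fst s \<in> h) = 1"
    using assms(2) by (simp add: cond_prob_def histories_def)
  then have "0 \<le> ln 2 * info_joint n S \<Omega> \<theta> h"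
    using info_joint_lower_bound[OF assms subset_refl] by (simp add: D_TV_def)
  then show ?thesis
    by (simp add: zero_le_mult_iff)
qed

section \<open>From the Gestalt complexity to the distance of beliefs\<close>

text \<open>The point to check is finiteness, without which \<open>Max\<close> gives no upper bound:
  histories are subsets of one finite product.\<close>

lemma info_joint_le_gestalt_complexity:
  assumes "information_structure n S \<Omega> \<theta>" "h \<in> histories n S \<theta>" "x \<in> h" "consensus n S \<Omega> \<theta> h \<epsilon>"
  shows "info_joint n S \<Omega> \<theta> h \<le> gestalt_complexity n S \<Omega> \<theta> x \<epsilon>"
proof -
  have "finite (\<Pi>\<^sub>E i\<in>{1..n}. S i)"
    using assms(1) by (auto simp: information_structure_def intro!: finite_PiE)
  moreover have "histories n S \<theta> \<subseteq> Pow (\<Pi>\<^sub>E i\<in>{1..n}. S i)"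
    by (auto simp: histories_def PiE_iff)
  ultimately have "finite (histories n S \<theta>)"
    using finite_subset by blast
  then show ?thesis
    unfolding gestalt_complexity_def using assms(2-4) by (intro Max_ge) auto
qed

text \<open>The intermediate point stands first in both distances, in the orientation that
  \<open>belief_close_to_refinement\<close> delivers.\<close>

lemma D_TV_triangle: "D_TV \<Omega> p r \<le> D_TV \<Omega> q p + D_TV \<Omega> q r"
  unfolding D_TV_def add_divide_distrib[symmetric] sum.distrib[symmetric]
  by (intro divide_right_mono sum_mono) auto

text \<open>With T the distance and J the information at h, the chain is p T^2 <= (ln 2) J / 2 <= J
  / 2 <= g / 2 < p (d / 2)^2, where the last step is the assumed lower bound on p. Cancelling p
  leaves T < d / 2.\<close>

lemma belief_close_to_refinement:
  assumes "information_structure n S \<Omega> \<theta>" "h \<in> histories n S \<theta>" "x \<in> h" "consensus n S \<Omega> \<theta> h \<epsilon>"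
    and "d > 0"
    and large: "\<P>(s in \<theta>. fst s \<in> h' \<bar> fst s \<in> h) > 2 * gestalt_complexity n S \<Omega> \<theta> x \<epsilon> / d\<^sup>2"
  shows "D_TV \<Omega> (belief \<theta> (h \<inter> h')) (belief \<theta> h) < d / 2"
proof -
  let ?g = "gestalt_complexity n S \<Omega> \<theta> x \<epsilon>" and ?J = "info_joint n S \<Omega> \<theta> h"
  let ?T = "D_TV \<Omega> (belief \<theta> (h \<inter> h')) (belief \<theta> h)"
  define p where "p = \<P>(s in \<theta>. fst s \<in> h' \<bar> fst s \<in> h)"
  \<comment> \<open>\<open>info_joint_lower_bound\<close> asks for a subset of h; given h, the
    events h' and \<open>h \<inter> h'\<close> are equally likely.\<close>
  have p: "p = \<P>(s in \<theta>. fst s \<in> h \<inter> h' \<bar> fst s \<in> h)"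
    unfolding p_def cond_prob_def by (intro arg_cong2[where f = "(/)"] arg_cong[where f = "measure \<theta>"]) auto
  have J: "0 \<le> ?J" "?J \<le> ?g"
    using assms by (auto intro: info_joint_nonneg info_joint_le_gestalt_complexity)
  \<comment> \<open>Nonnegative information makes the threshold nonnegative, so exceeding it
    strictly forces p > 0, as the cancellations below require.\<close>
  have "2 * ?g / d\<^sup>2 \<ge> 0"
    using J by simp
  then have "p > 0"
    using large p_def by linarith
  have "2 * ?g < p * d\<^sup>2"
    using large \<open>d > 0\<close> by (simp add: p_def field_simps)
  have "p * (p * ?T\<^sup>2) = (p * ?T)\<^sup>2"
    by (simp add: power2_eq_square)
  also have "\<dots> \<le> p * (ln 2 * ?J) / 2"
    using info_joint_lower_bound[OF assms(1,2), of "h \<inter> h'"] p by simp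
  also have "\<dots> \<le> p * (?J / 2)"
    using \<open>p > 0\<close> J ln_2_less_1 by (simp add: mult_left_le_one_le)
  also have "\<dots> < p * (p * (d / 2)\<^sup>2)"
    using \<open>p > 0\<close> J \<open>2 * ?g < p * d\<^sup>2\<close> by (simp add: power_divide)
  finally have "?T\<^sup>2 < (d / 2)\<^sup>2"
    using \<open>p > 0\<close> by simp
  then show ?thesis
    by (rule power_less_imp_less_base) (use \<open>d > 0\<close> in simp)
qed

theorem theorem4p4:
  fixes n :: nat and S :: "nat \<Rightarrow> 'a set" and \<Omega> :: "'w set"
    and \<theta> :: "((nat \<Rightarrow> 'a) \<times> 'w) measure"
    and x :: "nat \<Rightarrow> 'a" and \<epsilon> d :: real and h h' :: "(nat \<Rightarrow> 'a) set"
  assumes "information_structure n S \<Omega> \<theta>"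
    and "\<P>(s in \<theta>. fst s = x) > 0"
    and "\<epsilon> \<ge> 0" and "d > 0"
    and "h \<in> histories n S \<theta>" and "h' \<in> histories n S \<theta>"
    and "x \<in> h" and "x \<in> h'"
    and "consensus n S \<Omega> \<theta> h \<epsilon>" and "consensus n S \<Omega> \<theta> h' \<epsilon>"
    and "\<P>(s in \<theta>. fst s \<in> h \<bar> fst s \<in> h') > 2 * gestalt_complexity n S \<Omega> \<theta> x \<epsilon> / d\<^sup>2"
    and "\<P>(s in \<theta>. fst s \<in> h' \<bar> fst s \<in> h) > 2 * gestalt_complexity n S \<Omega> \<theta> x \<epsilon> / d\<^sup>2"
  shows "D_TV \<Omega> (belief \<theta> h) (belief \<theta> h') < d"
proof -
  have "D_TV \<Omega> (belief \<theta> (h \<inter> h')) (belief \<theta> h) < d / 2"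
    using assms by (intro belief_close_to_refinement)
  \<comment> \<open>The same lemma with h and h' exchanged; commuting the intersection shows that
    both distances start from the same intermediate belief.\<close>
  moreover have "D_TV \<Omega> (belief \<theta> (h \<inter> h')) (belief \<theta> h') < d / 2"
    using assms by (subst Int_commute) (intro belief_close_to_refinement)
  ultimately show ?thesis
    using D_TV_triangle[of \<Omega> "belief \<theta> h" "belief \<theta> h'" "belief \<theta> (h \<inter> h')"] by simp
qed

end
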